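(* Let $\mathbf{C}$ be an abelian category and consider in $\mathbf{C}$ a commutative diagram with rows $A \xrightarrow{a} B \xrightarrow{c} C$ and $A' \xrightarrow{b} B' \xrightarrow{d} C'$ and vertical arrows $u : A \to A'$, $v : B \to B'$, $w : C \to C'$, so that $va = bu$ and $wc = dv$. Let $i : \mathrm{Ker}(u) \to A$, $j : \mathrm{Ker}(v) \to B$, $k : \mathrm{Ker}(w) \to C$ be kernels of $u, v, w$ respectively, and let $p : A' \to \mathrm{Coker}(u)$, $q : B' \to \mathrm{Coker}(v)$, $r : C' \to \mathrm{Coker}(w)$ be their cokernels. Suppose that $c$ is a cokernel of $a$ and that $b$ is a kernel of $d$. Let $s : \mathrm{Ker}(u)\to \mathrm{Ker}(v)$, $t : \mathrm{Ker}(v) \to \mathrm{Ker}(w)$, $x : \mathrm{Coker}(u) \to \mathrm{Coker}(v)$, $y : \mathrm{Coker}(v) \to \mathrm{Coker}(w)$ be the induced arrows, i.e. the unique arrows with $js = ai$, $kt = cj$, $xp = qb$, $yq = rd$. Then there exists an arrow $\delta : \mathrm{Ker}(w) \to \mathrm{Coker}(u)$ such that the sequence $$\mathrm{Ker}(u) \xrightarrow{s} \mathrm{Ker}(v) \xrightarrow{t} \mathrm{Ker}(w) \xrightarrow{\delta} \mathrm{Coker}(u) \xrightarrow{x} \mathrm{Coker}(v) \xrightarrow{y} \mathrm{Coker}(w)$$ is exact.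
   Context: Two successive arrows $f, g$ (with $gf$ defined) in an abelian category, decomposed into epimorphisms followed by monomorphisms $f = mq$, $g = np$ ($q,p$ epimorphisms, $m,n$ monomorphisms), form an exact sequence $(f,g)$ when $m$ is a kernel of $p$ (equivalently, the image of $f$ is the kernel of $g$). A longer sequence is exact when every pair of successive arrows in it is exact; no condition is imposed at the two ends. *)

theory Defs
  imports "HOL-Algebra.Group"
begin

record ('o, 'm) cat =
  Obj :: "'o set"
  Arr :: "'m set"
  Dom :: "'m \<Rightarrow> 'o"
  Cod :: "'m \<Rightarrow> 'o"
  Ident :: "'o \<Rightarrow> 'm"
  Comp :: "'m \<Rightarrow> 'm \<Rightarrow> 'm"  (infixl "\<cdot>\<index>" 70)

text \<open>Composition is written in the applicative order: \<open>g \<cdot> f\<close> is \<open>f\<close> followed by \<open>g\<close>.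
  All operations are constrained only on objects and (composable or parallel) arrows.\<close>

definition Hom :: "('o, 'm, 'x) cat_scheme \<Rightarrow> 'o \<Rightarrow> 'o \<Rightarrow> 'm set" where
  "Hom C A B = {f \<in> Arr C. Dom C f = A \<and> Cod C f = B}"

locale category =
  fixes C :: "('o, 'm, 'x) cat_scheme" (structure)
  assumes Dom_closed: "f \<in> Arr C \<Longrightarrow> Dom C f \<in> Obj C"
    and Cod_closed: "f \<in> Arr C \<Longrightarrow> Cod C f \<in> Obj C"
    and Ident_closed: "A \<in> Obj C \<Longrightarrow> Ident C A \<in> Hom C A A"
    and Comp_closed: "\<lbrakk>f \<in> Hom C A B; g \<in> Hom C B D\<rbrakk> \<Longrightarrow> g \<cdot> f \<in> Hom C A D"
    and Comp_Ident: "f \<in> Hom C A B \<Longrightarrow> f \<cdot> Ident C A = f"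
    and Ident_Comp: "f \<in> Hom C A B \<Longrightarrow> Ident C B \<cdot> f = f"
    and Comp_assoc: "\<lbrakk>f \<in> Hom C A B; g \<in> Hom C B D; h \<in> Hom C D E\<rbrakk>
      \<Longrightarrow> (h \<cdot> g) \<cdot> f = h \<cdot> (g \<cdot> f)"

definition mono_arr :: "('o, 'm, 'x) cat_scheme \<Rightarrow> 'm \<Rightarrow> bool" where
  "mono_arr C m \<longleftrightarrow> m \<in> Arr C \<and>
    (\<forall>X. \<forall>g \<in> Hom C X (Dom C m). \<forall>h \<in> Hom C X (Dom C m).
      m \<cdot>\<^bsub>C\<^esub> g = m \<cdot>\<^bsub>C\<^esub> h \<longrightarrow> g = h)"

definition epi_arr :: "('o, 'm, 'x) cat_scheme \<Rightarrow> 'm \<Rightarrow> bool" where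
  "epi_arr C e \<longleftrightarrow> e \<in> Arr C \<and>
    (\<forall>X. \<forall>g \<in> Hom C (Cod C e) X. \<forall>h \<in> Hom C (Cod C e) X.
      g \<cdot>\<^bsub>C\<^esub> e = h \<cdot>\<^bsub>C\<^esub> e \<longrightarrow> g = h)"

record ('o, 'm) ab_cat = "('o, 'm) cat" +
  Plus :: "'m \<Rightarrow> 'm \<Rightarrow> 'm"  (infixl "\<oplus>\<index>" 65)
  Null :: "'o \<Rightarrow> 'o \<Rightarrow> 'm"

definition hom_group :: "('o, 'm, 'x) ab_cat_scheme \<Rightarrow> 'o \<Rightarrow> 'o \<Rightarrow> 'm monoid" where
  "hom_group C A B = \<lparr>carrier = Hom C A B, monoid.mult = Plus C, one = Null C A B\<rparr>"

locale preadditive_category = category C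
  for C :: "('o, 'm, 'x) ab_cat_scheme" (structure) +
  assumes hom_comm_group: "\<lbrakk>A \<in> Obj C; B \<in> Obj C\<rbrakk> \<Longrightarrow> comm_group (hom_group C A B)"
    and Comp_Plus_left: "\<lbrakk>f \<in> Hom C A B; g \<in> Hom C B D; g' \<in> Hom C B D\<rbrakk>
      \<Longrightarrow> (g \<oplus> g') \<cdot> f = (g \<cdot> f) \<oplus> (g' \<cdot> f)"
    and Comp_Plus_right: "\<lbrakk>f \<in> Hom C A B; f' \<in> Hom C A B; g \<in> Hom C B D\<rbrakk>
      \<Longrightarrow> g \<cdot> (f \<oplus> f') = (g \<cdot> f) \<oplus> (g \<cdot> f')"

definition is_kernel :: "('o, 'm, 'x) ab_cat_scheme \<Rightarrow> 'm \<Rightarrow> 'm \<Rightarrow> bool" where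
  "is_kernel C k f \<longleftrightarrow> f \<in> Arr C \<and> k \<in> Arr C \<and> Cod C k = Dom C f \<and>
    f \<cdot>\<^bsub>C\<^esub> k = Null C (Dom C k) (Cod C f) \<and>
    (\<forall>X. \<forall>h \<in> Hom C X (Dom C f). f \<cdot>\<^bsub>C\<^esub> h = Null C X (Cod C f) \<longrightarrow>
      (\<exists>!h'. h' \<in> Hom C X (Dom C k) \<and> k \<cdot>\<^bsub>C\<^esub> h' = h))"

definition is_cokernel :: "('o, 'm, 'x) ab_cat_scheme \<Rightarrow> 'm \<Rightarrow> 'm \<Rightarrow> bool" where
  "is_cokernel C e f \<longleftrightarrow> f \<in> Arr C \<and> e \<in> Arr C \<and> Dom C e = Cod C f \<and>
    e \<cdot>\<^bsub>C\<^esub> f = Null C (Dom C f) (Cod C e) \<and>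
    (\<forall>X. \<forall>h \<in> Hom C (Cod C f) X. h \<cdot>\<^bsub>C\<^esub> f = Null C (Dom C f) X \<longrightarrow>
      (\<exists>!h'. h' \<in> Hom C (Cod C e) X \<and> h' \<cdot>\<^bsub>C\<^esub> e = h))"

definition zero_object :: "('o, 'm, 'x) cat_scheme \<Rightarrow> 'o \<Rightarrow> bool" where
  "zero_object C Z \<longleftrightarrow> Z \<in> Obj C \<and>
    (\<forall>X \<in> Obj C. (\<exists>!f. f \<in> Hom C X Z) \<and> (\<exists>!f. f \<in> Hom C Z X))"

text \<open>Binary biproducts are given by the usual equations; in a preadditive category they imply
  \<open>p1 \<cdot> i2 = 0\<close>, \<open>p2 \<cdot> i1 = 0\<close> and the universal properties of product and coproduct.\<close>

definition is_biproduct ::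
  "('o, 'm, 'x) ab_cat_scheme \<Rightarrow> 'o \<Rightarrow> 'o \<Rightarrow> 'o \<Rightarrow> 'm \<Rightarrow> 'm \<Rightarrow> 'm \<Rightarrow> 'm \<Rightarrow> bool" where
  "is_biproduct C A B P p1 p2 i1 i2 \<longleftrightarrow> P \<in> Obj C \<and>
    p1 \<in> Hom C P A \<and> p2 \<in> Hom C P B \<and> i1 \<in> Hom C A P \<and> i2 \<in> Hom C B P \<and>
    p1 \<cdot>\<^bsub>C\<^esub> i1 = Ident C A \<and> p2 \<cdot>\<^bsub>C\<^esub> i2 = Ident C B \<and>
    (i1 \<cdot>\<^bsub>C\<^esub> p1) \<oplus>\<^bsub>C\<^esub> (i2 \<cdot>\<^bsub>C\<^esub> p2) = Ident C P"

locale abelian_category = preadditive_category C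
  for C :: "('o, 'm, 'x) ab_cat_scheme" (structure) +
  assumes has_zero_object: "\<exists>Z. zero_object C Z"
    and has_biproducts: "\<lbrakk>A \<in> Obj C; B \<in> Obj C\<rbrakk>
      \<Longrightarrow> \<exists>P p1 p2 i1 i2. is_biproduct C A B P p1 p2 i1 i2"
    and has_kernels: "f \<in> Arr C \<Longrightarrow> \<exists>k. is_kernel C k f"
    and has_cokernels: "f \<in> Arr C \<Longrightarrow> \<exists>e. is_cokernel C e f"
    and mono_is_kernel: "mono_arr C m \<Longrightarrow> \<exists>f. is_kernel C m f"
    and epi_is_cokernel: "epi_arr C e \<Longrightarrow> \<exists>f. is_cokernel C e f"

definition exact_pair :: "('o, 'm, 'x) ab_cat_scheme \<Rightarrow> 'm \<Rightarrow> 'm \<Rightarrow> bool" where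
  "exact_pair C f g \<longleftrightarrow> f \<in> Arr C \<and> g \<in> Arr C \<and> Cod C f = Dom C g \<and>
    (\<exists>m q n p. epi_arr C q \<and> mono_arr C m \<and> Cod C q = Dom C m \<and> f = m \<cdot>\<^bsub>C\<^esub> q \<and>
               epi_arr C p \<and> mono_arr C n \<and> Cod C p = Dom C n \<and> g = n \<cdot>\<^bsub>C\<^esub> p \<and>
               is_kernel C m p)"

text \<open>Sequences are listed in diagram order, the first arrow of the sequence first.\<close>

definition exact_sequence :: "('o, 'm, 'x) ab_cat_scheme \<Rightarrow> 'm list \<Rightarrow> bool" where
  "exact_sequence C fs \<longleftrightarrow>
    (\<forall>l. Suc l < length fs \<longrightarrow> exact_pair C (fs ! l) (fs ! Suc l))"

end

theory Submission
  imports Defs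
begin

text \<open>The proof is a diagram chase with generalized elements. An element of \<open>B\<close> is an arrow
  \<open>h : X \<rightarrow> B\<close>, and it may be replaced by its restriction \<open>h \<cdot> e\<close> along an epimorphism
  \<open>e : Y \<rightarrow> X\<close>. Up to such restriction, choosing a preimage is as harmless in an abelian category
  as it is for modules: epimorphisms are stable under pullback (\<open>epi_pullback\<close>), so elements lift
  along epimorphisms, and every arrow is an epimorphism onto the kernel of its cokernel
  (\<open>image_factorization\<close>), so an element killed by the cokernel of \<open>f\<close> lifts along \<open>f\<close>
  (\<open>cokernel_lift\<close>). Conversely, a composable pair with zero composite is exact as soon as every
  element killed by the second arrow lifts, up to restriction, along the first (\<open>exact_pairI\<close>).

  With this dictionary the four exactness claims become the familiar chases. Only the connecting
  arrow has to be constructed as an arrow: the relation sending \<open>h \<in> Ker w\<close> to the class \<open>p \<cdot> \<alpha>\<close>,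
  whenever \<open>c \<cdot> \<beta> = k \<cdot> h\<close> and \<open>v \<cdot> \<beta> = b \<cdot> \<alpha>\<close>, is evaluated at the universal such pair
  \<open>(\<beta>, h)\<close>, which lives on the pullback of \<open>c\<close> and \<open>k\<close>. The projection of this pullback to
  \<open>Ker w\<close> is an epimorphism, hence the cokernel of its kernel, and \<open>p \<cdot> \<alpha>\<close> kills that kernel
  because the indeterminacy of \<open>\<beta>\<close> comes from \<open>A\<close>. The universal property of the pullback then gives
  the rule for all elements, and the chases at \<open>Ker w\<close> and \<open>Coker u\<close> refer to \<open>\<delta>\<close> only
  through this rule.\<close>

section \<open>Arrows in categories and preadditive categories\<close>


context category
begin

lemma Hom_Obj: "f \<in> Hom C A B \<Longrightarrow> A \<in> Obj C" "f \<in> Hom C A B \<Longrightarrow> B \<in> Obj C"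
  using Dom_closed Cod_closed by (auto simp: Hom_def)

text \<open>Composition only associates for arrows with matching ends, so commutative squares are applied to
  elements in this form.\<close>

lemma Comp_square:
  assumes "g \<cdot> f = g' \<cdot> f'" and f: "f \<in> Hom C A B" "g \<in> Hom C B D"
    and f': "f' \<in> Hom C A B'" "g' \<in> Hom C B' D" and h: "h \<in> Hom C X A"
  shows "g \<cdot> (f \<cdot> h) = g' \<cdot> (f' \<cdot> h)"
  using Comp_assoc[OF h f] Comp_assoc[OF h f'] assms(1) by simp

lemma mono_arrD:
  "\<lbrakk>mono_arr C m; m \<in> Hom C A B; g \<in> Hom C X A; h \<in> Hom C X A; m \<cdot> g = m \<cdot> h\<rbrakk> \<Longrightarrow> g = h"
  by (auto simp: mono_arr_def Hom_def)

lemma epi_arrD: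
  "\<lbrakk>epi_arr C e; e \<in> Hom C A B; g \<in> Hom C B X; h \<in> Hom C B X; g \<cdot> e = h \<cdot> e\<rbrakk> \<Longrightarrow> g = h"
  by (auto simp: epi_arr_def Hom_def)

lemma mono_arrI:
  assumes "m \<in> Hom C A B"
    and "\<And>X g h. \<lbrakk>g \<in> Hom C X A; h \<in> Hom C X A; m \<cdot> g = m \<cdot> h\<rbrakk> \<Longrightarrow> g = h"
  shows "mono_arr C m"
  using assms unfolding mono_arr_def by (auto simp: Hom_def)

lemma epi_arrI:
  assumes "e \<in> Hom C A B"
    and "\<And>X g h. \<lbrakk>g \<in> Hom C B X; h \<in> Hom C B X; g \<cdot> e = h \<cdot> e\<rbrakk> \<Longrightarrow> g = h"
  shows "epi_arr C e"
  using assms unfolding epi_arr_def by (auto simp: Hom_def)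

lemma mono_Comp:
  assumes m: "mono_arr C m" "m \<in> Hom C A B" and n: "mono_arr C n" "n \<in> Hom C B D"
  shows "mono_arr C (n \<cdot> m)"
proof (rule mono_arrI)
  show "n \<cdot> m \<in> Hom C A D" using m n Comp_closed by blast
next
  fix X g h assume gh: "g \<in> Hom C X A" "h \<in> Hom C X A" "n \<cdot> m \<cdot> g = n \<cdot> m \<cdot> h"
  then have "n \<cdot> (m \<cdot> g) = n \<cdot> (m \<cdot> h)"
    using Comp_assoc[OF gh(1) m(2) n(2)] Comp_assoc[OF gh(2) m(2) n(2)] by simp
  then have "m \<cdot> g = m \<cdot> h"
    by (rule mono_arrD[OF n Comp_closed[OF gh(1) m(2)] Comp_closed[OF gh(2) m(2)]])
  then show "g = h" by (rule mono_arrD[OF m gh(1,2)])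
qed

lemma epi_Comp:
  assumes e: "epi_arr C e" "e \<in> Hom C A B" and d: "epi_arr C d" "d \<in> Hom C B D"
  shows "epi_arr C (d \<cdot> e)"
proof (rule epi_arrI)
  show "d \<cdot> e \<in> Hom C A D" using e d Comp_closed by blast
next
  fix X g h assume gh: "g \<in> Hom C D X" "h \<in> Hom C D X" "g \<cdot> (d \<cdot> e) = h \<cdot> (d \<cdot> e)"
  then have "(g \<cdot> d) \<cdot> e = (h \<cdot> d) \<cdot> e"
    using Comp_assoc[OF e(2) d(2) gh(1)] Comp_assoc[OF e(2) d(2) gh(2)] by simp
  then have "g \<cdot> d = h \<cdot> d"
    by (rule epi_arrD[OF e Comp_closed[OF d(2) gh(1)] Comp_closed[OF d(2) gh(2)]])
  then show "g = h" by (rule epi_arrD[OF d gh(1,2)])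
qed

end

context preadditive_category
begin

lemma Null_closed:
  assumes "A \<in> Obj C" "B \<in> Obj C"
  shows "Null C A B \<in> Hom C A B"
proof -
  interpret G: comm_group "hom_group C A B" using assms by (rule hom_comm_group)
  show ?thesis using G.one_closed by (simp add: hom_group_def)
qed

lemma Plus_closed:
  assumes f: "f \<in> Hom C A B" and g: "g \<in> Hom C A B"
  shows "f \<oplus> g \<in> Hom C A B"
proof -
  interpret G: comm_group "hom_group C A B" using Hom_Obj[OF f] by (rule hom_comm_group)
  show ?thesis using G.m_closed[of f g] f g by (simp add: hom_group_def)
qed

lemma Plus_commute:
  assumes f: "f \<in> Hom C A B" and g: "g \<in> Hom C A B"
  shows "f \<oplus> g = g \<oplus> f"
proof -
  interpret G: comm_group "hom_group C A B" using Hom_Obj[OF f] by (rule hom_comm_group)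
  show ?thesis using G.m_comm[of f g] f g by (simp add: hom_group_def)
qed

lemma Null_Plus:
  assumes f: "f \<in> Hom C A B"
  shows "Null C A B \<oplus> f = f"
proof -
  interpret G: comm_group "hom_group C A B" using Hom_Obj[OF f] by (rule hom_comm_group)
  show ?thesis using G.l_one[of f] f by (simp add: hom_group_def)
qed

lemma Plus_cancel_right:
  assumes "f \<in> Hom C A B" "g \<in> Hom C A B" "h \<in> Hom C A B" "f \<oplus> h = g \<oplus> h"
  shows "f = g"
proof -
  interpret G: comm_group "hom_group C A B" using Hom_Obj[OF assms(1)] by (rule hom_comm_group)
  show ?thesis using assms G.right_cancel[of h f g] by (simp add: hom_group_def)
qed

lemma difference_exists:
  assumes f: "f \<in> Hom C A B" and g: "g \<in> Hom C A B"
  obtains h where "h \<in> Hom C A B" "h \<oplus> g = f"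
proof -
  interpret G: comm_group "hom_group C A B" using Hom_Obj[OF f] by (rule hom_comm_group)
  have *: "f \<in> carrier (hom_group C A B)" "g \<in> carrier (hom_group C A B)"
    using f g by (simp_all add: hom_group_def)
  define h where "h = f \<otimes>\<^bsub>hom_group C A B\<^esub> inv\<^bsub>hom_group C A B\<^esub> g"
  have "h \<in> carrier (hom_group C A B)" "h \<otimes>\<^bsub>hom_group C A B\<^esub> g = f"
    using * by (simp_all add: h_def G.m_assoc)
  then show thesis using that by (simp add: hom_group_def)
qed

lemma Null_Comp:
  assumes f: "f \<in> Hom C A B" and D: "D \<in> Obj C"
  shows "Null C B D \<cdot> f = Null C A D"
proof -
  note N = Null_closed[OF Hom_Obj(2)[OF f] D]
  note cl = Comp_closed[OF f N]
  have "Null C B D \<cdot> f \<oplus> Null C B D \<cdot> f = Null C A D \<oplus> Null C B D \<cdot> f"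
    using Comp_Plus_left[OF f N N] by (simp add: Null_Plus[OF N] Null_Plus[OF cl])
  then show ?thesis by (rule Plus_cancel_right[OF cl Null_closed[OF Hom_Obj(1)[OF f] D] cl])
qed

lemma Comp_Null:
  assumes g: "g \<in> Hom C B D" and A: "A \<in> Obj C"
  shows "g \<cdot> Null C A B = Null C A D"
proof -
  note N = Null_closed[OF A Hom_Obj(1)[OF g]]
  note cl = Comp_closed[OF N g]
  have "g \<cdot> Null C A B \<oplus> g \<cdot> Null C A B = Null C A D \<oplus> g \<cdot> Null C A B"
    using Comp_Plus_right[OF N N g] by (simp add: Null_Plus[OF N] Null_Plus[OF cl])
  then show ?thesis by (rule Plus_cancel_right[OF cl Null_closed[OF A Hom_Obj(2)[OF g]] cl])
qed

text \<open>Two elements with the same image differ by an element of the kernel. The difference is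
  characterized additively, which spares the chases a subtraction on the groups of arrows.\<close>

lemma difference_annihilated:
  assumes f: "f \<in> Hom C A B" and g: "g \<in> Hom C A B" and q: "q \<in> Hom C B D"
    and eq: "q \<cdot> f = q \<cdot> g"
  obtains h where "h \<in> Hom C A B" "h \<oplus> g = f" "q \<cdot> h = Null C A D"
proof -
  obtain h where h: "h \<in> Hom C A B" "h \<oplus> g = f" using difference_exists[OF f g] by blast
  note cl = Comp_closed[OF h(1) q] Comp_closed[OF g q]
  have "q \<cdot> h \<oplus> q \<cdot> g = Null C A D \<oplus> q \<cdot> g"
    using Comp_Plus_right[OF h(1) g q] h(2) eq Null_Plus[OF cl(2)] by simp
  then have "q \<cdot> h = Null C A D"
    by (rule Plus_cancel_right[OF cl(1) Null_closed[OF Hom_Obj[OF cl(1)]] cl(2)])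
  then show thesis using that h by simp
qed

lemma Comp_eq_Null:
  assumes "g \<cdot> f = Null C A D" "f \<in> Hom C A B" "g \<in> Hom C B D" "h \<in> Hom C X A"
  shows "g \<cdot> (f \<cdot> h) = Null C X D"
  using Comp_assoc[OF assms(4,2,3)] assms(1) Null_Comp[OF assms(4) Hom_Obj(2)[OF assms(3)]]
  by simp

lemma Comp_eq_Null':
  assumes "g \<cdot> f = Null C A D" "f \<in> Hom C A B" "g \<in> Hom C B D" "h \<in> Hom C D X"
  shows "(h \<cdot> g) \<cdot> f = Null C A X"
  using Comp_assoc[OF assms(2,3,4)] assms(1) Comp_Null[OF assms(4) Hom_Obj(1)[OF assms(2)]]
  by simp

lemma mono_arr_eq_Null:
  assumes m: "mono_arr C m" "m \<in> Hom C A B" and g: "g \<in> Hom C X A" "m \<cdot> g = Null C X B"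
  shows "g = Null C X A"
proof (rule mono_arrD[OF m g(1)])
  note X = Hom_Obj(1)[OF g(1)]
  show "Null C X A \<in> Hom C X A" using Null_closed[OF X Hom_Obj(1)[OF m(2)]] .
  show "m \<cdot> g = m \<cdot> Null C X A" using g(2) Comp_Null[OF m(2) X] by simp
qed

lemma epi_arr_eq_Null:
  assumes e: "epi_arr C e" "e \<in> Hom C A B" and g: "g \<in> Hom C B X" "g \<cdot> e = Null C A X"
  shows "g = Null C B X"
proof (rule epi_arrD[OF e g(1)])
  note X = Hom_Obj(2)[OF g(1)]
  show "Null C B X \<in> Hom C B X" using Null_closed[OF Hom_Obj(2)[OF e(2)] X] .
  show "g \<cdot> e = Null C B X \<cdot> e" using g(2) Null_Comp[OF e(2) X] by simp
qed

lemma epi_arr_zeroI: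
  assumes e: "e \<in> Hom C A B"
    and zero: "\<And>X g. \<lbrakk>g \<in> Hom C B X; g \<cdot> e = Null C A X\<rbrakk> \<Longrightarrow> g = Null C B X"
  shows "epi_arr C e"
proof (rule epi_arrI[OF e])
  fix X g h assume gh: "g \<in> Hom C B X" "h \<in> Hom C B X" "g \<cdot> e = h \<cdot> e"
  obtain l where l: "l \<in> Hom C B X" "l \<oplus> h = g" using difference_exists gh by blast
  have cl: "l \<cdot> e \<in> Hom C A X" "h \<cdot> e \<in> Hom C A X" "Null C A X \<in> Hom C A X"
    using l gh e Comp_closed Null_closed Hom_Obj by blast+
  have "l \<cdot> e \<oplus> h \<cdot> e = Null C A X \<oplus> h \<cdot> e"
    using Comp_Plus_left[OF e l(1) gh(2)] l gh Null_Plus[OF cl(2)] by simp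
  then have "l \<cdot> e = Null C A X" using cl Plus_cancel_right by blast
  then have "l = Null C B X" using zero l by blast
  then show "g = h" using l(2) Null_Plus[OF gh(2)] by simp
qed

section \<open>Kernels and cokernels\<close>

lemma kernelD:
  assumes "is_kernel C k f"
  shows "k \<in> Hom C (Dom C k) (Dom C f)" "f \<in> Hom C (Dom C f) (Cod C f)"
    "f \<cdot> k = Null C (Dom C k) (Cod C f)"
    "\<lbrakk>h \<in> Hom C X (Dom C f); f \<cdot> h = Null C X (Cod C f)\<rbrakk>
      \<Longrightarrow> \<exists>!h'. h' \<in> Hom C X (Dom C k) \<and> k \<cdot> h' = h"
proof -
  from assms have "f \<in> Arr C" "k \<in> Arr C" "Cod C k = Dom C f"
    unfolding is_kernel_def by blast+
  then show "k \<in> Hom C (Dom C k) (Dom C f)" "f \<in> Hom C (Dom C f) (Cod C f)"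
    by (simp_all add: Hom_def)
  from assms show "f \<cdot> k = Null C (Dom C k) (Cod C f)"
    unfolding is_kernel_def by (elim conjE)
  from assms show "\<lbrakk>h \<in> Hom C X (Dom C f); f \<cdot> h = Null C X (Cod C f)\<rbrakk>
      \<Longrightarrow> \<exists>!h'. h' \<in> Hom C X (Dom C k) \<and> k \<cdot> h' = h"
    unfolding is_kernel_def by (elim conjE) simp
qed

lemma cokernelD:
  assumes "is_cokernel C e f"
  shows "e \<in> Hom C (Cod C f) (Cod C e)" "f \<in> Hom C (Dom C f) (Cod C f)"
    "e \<cdot> f = Null C (Dom C f) (Cod C e)"
    "\<lbrakk>h \<in> Hom C (Cod C f) X; h \<cdot> f = Null C (Dom C f) X\<rbrakk>
      \<Longrightarrow> \<exists>!h'. h' \<in> Hom C (Cod C e) X \<and> h' \<cdot> e = h"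
proof -
  from assms have "f \<in> Arr C" "e \<in> Arr C" "Dom C e = Cod C f"
    unfolding is_cokernel_def by blast+
  then show "e \<in> Hom C (Cod C f) (Cod C e)" "f \<in> Hom C (Dom C f) (Cod C f)"
    by (simp_all add: Hom_def)
  from assms show "e \<cdot> f = Null C (Dom C f) (Cod C e)"
    unfolding is_cokernel_def by (elim conjE)
  from assms show "\<lbrakk>h \<in> Hom C (Cod C f) X; h \<cdot> f = Null C (Dom C f) X\<rbrakk>
      \<Longrightarrow> \<exists>!h'. h' \<in> Hom C (Cod C e) X \<and> h' \<cdot> e = h"
    unfolding is_cokernel_def by (elim conjE) simp
qed

lemma kernel_comp:
  assumes "is_kernel C k f" "f \<in> Hom C A B" "k \<in> Hom C K A"
  shows "f \<cdot> k = Null C K B"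
  using kernelD(3)[OF assms(1)] assms(2,3) by (simp add: Hom_def)

lemma cokernel_comp:
  assumes "is_cokernel C e f" "f \<in> Hom C A B" "e \<in> Hom C B Q"
  shows "e \<cdot> f = Null C A Q"
  using cokernelD(3)[OF assms(1)] assms(2,3) by (simp add: Hom_def)

lemma kernel_factor:
  assumes k: "is_kernel C k f" "f \<in> Hom C A B" "k \<in> Hom C K A"
    and h: "h \<in> Hom C X A" "f \<cdot> h = Null C X B"
  obtains h' where "h' \<in> Hom C X K" "k \<cdot> h' = h"
proof -
  have "Dom C f = A" "Cod C f = B" "Dom C k = K" using k(2,3) by (simp_all add: Hom_def)
  then show thesis using kernelD(4)[OF k(1), of h X] h that by auto
qed

lemma cokernel_factor:
  assumes e: "is_cokernel C e f" "f \<in> Hom C A B" "e \<in> Hom C B Q"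
    and h: "h \<in> Hom C B X" "h \<cdot> f = Null C A X"
  obtains h' where "h' \<in> Hom C Q X" "h' \<cdot> e = h"
proof -
  have "Dom C f = A" "Cod C f = B" "Cod C e = Q" using e(2,3) by (simp_all add: Hom_def)
  then show thesis using cokernelD(4)[OF e(1), of h X] h that by auto
qed

lemma kernel_mono:
  assumes k: "is_kernel C k f"
  shows "mono_arr C k"
proof (rule mono_arrI[OF kernelD(1)[OF k]])
  note kf = kernelD(1-3)[OF k]
  fix X g h assume gh: "g \<in> Hom C X (Dom C k)" "h \<in> Hom C X (Dom C k)" "k \<cdot> g = k \<cdot> h"
  have "\<exists>!h'. h' \<in> Hom C X (Dom C k) \<and> k \<cdot> h' = k \<cdot> h"
    by (rule kernelD(4)[OF k Comp_closed[OF gh(2) kf(1)] Comp_eq_Null[OF kf(3,1,2) gh(2)]])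
  then show "g = h" using gh by blast
qed

lemma cokernel_epi:
  assumes e: "is_cokernel C e f"
  shows "epi_arr C e"
proof (rule epi_arrI[OF cokernelD(1)[OF e]])
  note ef = cokernelD(1-3)[OF e]
  fix X g h assume gh: "g \<in> Hom C (Cod C e) X" "h \<in> Hom C (Cod C e) X" "g \<cdot> e = h \<cdot> e"
  have "\<exists>!h'. h' \<in> Hom C (Cod C e) X \<and> h' \<cdot> e = h \<cdot> e"
    by (rule cokernelD(4)[OF e Comp_closed[OF ef(1) gh(2)] Comp_eq_Null'[OF ef(3,2,1) gh(2)]])
  then show "g = h" using gh by blast
qed

end

context abelian_category
begin

lemma kernel_exists:
  assumes f: "f \<in> Hom C A B"
  obtains K k where "k \<in> Hom C K A" "is_kernel C k f"
proof -
  have "f \<in> Arr C" "Dom C f = A" using f by (simp_all add: Hom_def)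
  then obtain k where k: "is_kernel C k f" using has_kernels by blast
  then show thesis using kernelD(1)[OF k] \<open>Dom C f = A\<close> that by simp
qed

lemma cokernel_exists:
  assumes f: "f \<in> Hom C A B"
  obtains Q e where "e \<in> Hom C B Q" "is_cokernel C e f"
proof -
  have "f \<in> Arr C" "Cod C f = B" using f by (simp_all add: Hom_def)
  then obtain e where e: "is_cokernel C e f" using has_cokernels by blast
  then show thesis using cokernelD(1)[OF e] \<open>Cod C f = B\<close> that by simp
qed

text \<open>If \<open>e\<close> is a cokernel of some \<open>f\<close>, then \<open>f\<close> factors through the kernel \<open>k\<close> of \<open>e\<close>, so whatever
  kills \<open>k\<close> kills \<open>f\<close>.\<close>

lemma epi_cokernel_of_kernel:
  assumes e: "epi_arr C e" "e \<in> Hom C A B" and k: "is_kernel C k e" "k \<in> Hom C K A"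
    and g: "g \<in> Hom C A X" "g \<cdot> k = Null C K X"
  obtains g' where "g' \<in> Hom C B X" "g' \<cdot> e = g"
proof -
  obtain f where f: "is_cokernel C e f" using epi_is_cokernel e by blast
  have fH: "f \<in> Hom C (Dom C f) A" using cokernelD(1,2)[OF f] e(2) by (simp add: Hom_def)
  obtain f' where f': "f' \<in> Hom C (Dom C f) K" "k \<cdot> f' = f"
    using kernel_factor[OF k(1) e(2) k(2) fH cokernel_comp[OF f fH e(2)]] by blast
  have "g \<cdot> f = Null C (Dom C f) X" using Comp_eq_Null[OF g(2) k(2) g(1) f'(1)] f'(2) by simp
  then show thesis using cokernel_factor[OF f fH e(2) g(1)] that by blast
qed

section \<open>Lifting elements along epimorphisms\<close>

text \<open>Composing \<open>i1 \<cdot> p1 \<oplus> i2 \<cdot> p2 = 1\<close> with \<open>i1\<close> gives \<open>i2 \<cdot> p2 \<cdot> i1 = 0\<close>, and \<open>p2\<close> is a retraction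
  of \<open>i2\<close>.\<close>

lemma biproduct_orthogonal:
  assumes "is_biproduct C A B P p1 p2 i1 i2"
  shows "p1 \<cdot> i2 = Null C B A" "p2 \<cdot> i1 = Null C A B"
proof -
  \<comment> \<open>The two claims differ by swapping the summands; the summand \<open>E\<close> has projection \<open>l\<close> and
    injection \<open>i\<close>, the summand \<open>F\<close> has \<open>r\<close> and \<open>k\<close>.\<close>
  have ortho: "r \<cdot> i = Null C E F"
    if H: "l \<in> Hom C P E" "r \<in> Hom C P F" "i \<in> Hom C E P" "k \<in> Hom C F P"
      and li: "l \<cdot> i = Ident C E" and rk: "r \<cdot> k = Ident C F"
      and sum: "i \<cdot> l \<oplus> k \<cdot> r = Ident C P" for l r i k E F
  proof -
    have cl: "r \<cdot> i \<in> Hom C E F" "k \<cdot> r \<in> Hom C P P" "i \<cdot> l \<in> Hom C P P"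
      "(k \<cdot> r) \<cdot> i \<in> Hom C E P" "Null C E P \<in> Hom C E P"
      using Comp_closed[OF H(3,2)] Comp_closed[OF H(2,4)] Comp_closed[OF H(1,3)]
        Comp_closed[OF H(3) Comp_closed[OF H(2,4)]] Null_closed[OF Hom_Obj[OF H(3)]] by simp_all
    have "(i \<cdot> l \<oplus> k \<cdot> r) \<cdot> i = (i \<cdot> l) \<cdot> i \<oplus> (k \<cdot> r) \<cdot> i"
      by (rule Comp_Plus_left[OF H(3) cl(3,2)])
    moreover have "(i \<cdot> l) \<cdot> i = i" using Comp_assoc[OF H(3,1,3)] li Comp_Ident[OF H(3)] by simp
    ultimately have "i \<oplus> (k \<cdot> r) \<cdot> i = i" using sum Ident_Comp[OF H(3)] by metis
    then have "(k \<cdot> r) \<cdot> i \<oplus> i = Null C E P \<oplus> i"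
      using Plus_commute[OF H(3) cl(4)] Null_Plus[OF H(3)] by metis
    then have "(k \<cdot> r) \<cdot> i = Null C E P" by (rule Plus_cancel_right[OF cl(4,5) H(3)])
    then have "k \<cdot> (r \<cdot> i) = Null C E P" using Comp_assoc[OF H(3,2,4)] by simp
    then have "(r \<cdot> k) \<cdot> (r \<cdot> i) = Null C E F"
      using Comp_assoc[OF cl(1) H(4,2)] Comp_Null[OF H(2) Hom_Obj(1)[OF H(3)]] by simp
    then show ?thesis using rk Ident_Comp[OF cl(1)] by simp
  qed
  have H: "p1 \<in> Hom C P A" "p2 \<in> Hom C P B" "i1 \<in> Hom C A P" "i2 \<in> Hom C B P"
    and id: "p1 \<cdot> i1 = Ident C A" "p2 \<cdot> i2 = Ident C B" "i1 \<cdot> p1 \<oplus> i2 \<cdot> p2 = Ident C P"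
    using assms unfolding is_biproduct_def by blast+
  have "i2 \<cdot> p2 \<oplus> i1 \<cdot> p1 = Ident C P"
    using id(3) Plus_commute[OF Comp_closed[OF H(1,3)] Comp_closed[OF H(2,4)]] by simp
  then show "p1 \<cdot> i2 = Null C B A" using ortho[OF H(2,1,4,3) id(2,1)] by simp
  show "p2 \<cdot> i1 = Null C A B" using ortho[OF H(1,2,3,4) id] by simp
qed

text \<open>The pullback of \<open>f\<close> and \<open>g\<close> is the kernel of \<open>\<phi> = (f, -g)\<close> on the biproduct of \<open>A\<close> and \<open>X\<close>. As
  \<open>\<phi>\<close> restricts to \<open>f\<close> on \<open>A\<close>, it is an epimorphism and so the cokernel of this kernel. Let
  \<open>l\<close> be an arrow on \<open>X\<close> that kills the projection of the pullback to \<open>X\<close>. Then \<open>l \<cdot> pX = l' \<cdot> \<phi>\<close> for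
  some \<open>l'\<close>, and restricting to the summand \<open>A\<close> gives \<open>l' \<cdot> f = 0\<close>; so \<open>l'\<close> and with it \<open>l\<close> vanish.\<close>

lemma epi_pullback:
  assumes f: "epi_arr C f" "f \<in> Hom C A B" and g: "g \<in> Hom C X B"
  obtains P f' g' where "f' \<in> Hom C P X" "g' \<in> Hom C P A" "epi_arr C f'" "f \<cdot> g' = g \<cdot> f'"
    "\<And>Y r s. \<lbrakk>r \<in> Hom C Y A; s \<in> Hom C Y X; f \<cdot> r = g \<cdot> s\<rbrakk>
      \<Longrightarrow> \<exists>h \<in> Hom C Y P. g' \<cdot> h = r \<and> f' \<cdot> h = s"
proof -
  have ob: "A \<in> Obj C" "X \<in> Obj C" "B \<in> Obj C" using f g Hom_Obj by blast+
  obtain S pA pX iA iX where bp: "is_biproduct C A X S pA pX iA iX"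
    using has_biproducts ob by blast
  then have H: "pA \<in> Hom C S A" "pX \<in> Hom C S X" "iA \<in> Hom C A S" "iX \<in> Hom C X S"
    and id: "pA \<cdot> iA = Ident C A" "pX \<cdot> iX = Ident C X"
    unfolding is_biproduct_def by blast+
  note ortho = biproduct_orthogonal[OF bp]
  \<comment> \<open>\<open>n\<close> is the negative of \<open>g\<close>\<close>
  obtain n where n: "n \<in> Hom C X B" "n \<oplus> g = Null C X B"
    using difference_exists[OF Null_closed g] ob by blast
  define \<phi> where "\<phi> = f \<cdot> pA \<oplus> n \<cdot> pX"
  have \<phi>: "\<phi> \<in> Hom C S B" unfolding \<phi>_def using f n H Comp_closed Plus_closed by blast
  have \<phi>_Comp: "\<phi> \<cdot> h = f \<cdot> (pA \<cdot> h) \<oplus> n \<cdot> (pX \<cdot> h)" if h: "h \<in> Hom C Y S" for h Y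
    unfolding \<phi>_def
    using Comp_Plus_left[OF h Comp_closed[OF H(1) f(2)] Comp_closed[OF H(2) n(1)]]
      Comp_assoc[OF h H(1) f(2)] Comp_assoc[OF h H(2) n(1)] by simp
  have square: "f \<cdot> r \<oplus> n \<cdot> s = Null C Y B \<longleftrightarrow> f \<cdot> r = g \<cdot> s"
    if rs: "r \<in> Hom C Y A" "s \<in> Hom C Y X" for r s Y
  proof -
    have cl: "f \<cdot> r \<in> Hom C Y B" "n \<cdot> s \<in> Hom C Y B" "g \<cdot> s \<in> Hom C Y B"
      using f g n rs Comp_closed by blast+
    have "n \<cdot> s \<oplus> g \<cdot> s = Null C Y B"
      using Comp_Plus_left[OF rs(2) n(1) g] n(2) Null_Comp[OF rs(2) ob(3)] by simp
    then have "g \<cdot> s \<oplus> n \<cdot> s = Null C Y B" using Plus_commute[OF cl(2,3)] by simp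
    then show ?thesis using Plus_cancel_right[OF cl(1,3,2)] by auto
  qed
  have "\<phi> \<cdot> iA = f \<cdot> Ident C A \<oplus> n \<cdot> Null C A X" using \<phi>_Comp[OF H(3)] id ortho by simp
  also have "\<dots> = f"
    using Comp_Ident[OF f(2)] Comp_Null[OF n(1) ob(1)] Null_Plus[OF f(2)]
      Plus_commute[OF f(2) Null_closed[OF ob(1,3)]] by simp
  finally have \<phi>_iA: "\<phi> \<cdot> iA = f" .
  have l_f: "l \<cdot> f = (l \<cdot> \<phi>) \<cdot> iA" if "l \<in> Hom C B Y" for l Y
    using Comp_assoc[OF H(3) \<phi> that] \<phi>_iA by simp
  have \<phi>_epi: "epi_arr C \<phi>"
  proof (rule epi_arr_zeroI[OF \<phi>])
    fix Y l assume l: "l \<in> Hom C B Y" "l \<cdot> \<phi> = Null C S Y"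
    then have "l \<cdot> f = Null C A Y"
      using l_f[OF l(1)] Null_Comp[OF H(3) Hom_Obj(2)[OF l(1)]] by simp
    then show "l = Null C B Y" using epi_arr_eq_Null[OF f l(1)] by simp
  qed
  obtain P \<kappa> where \<kappa>: "\<kappa> \<in> Hom C P S" "is_kernel C \<kappa> \<phi>" using kernel_exists[OF \<phi>] by blast
  have cl: "pX \<cdot> \<kappa> \<in> Hom C P X" "pA \<cdot> \<kappa> \<in> Hom C P A" using \<kappa> H Comp_closed by blast+
  have comm: "f \<cdot> (pA \<cdot> \<kappa>) = g \<cdot> (pX \<cdot> \<kappa>)"
    using square[OF cl(2,1)] \<phi>_Comp[OF \<kappa>(1)] kernel_comp[OF \<kappa>(2) \<phi> \<kappa>(1)] by simp
  have epi: "epi_arr C (pX \<cdot> \<kappa>)"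
  proof (rule epi_arr_zeroI[OF cl(1)])
    fix Y l assume l: "l \<in> Hom C X Y" "l \<cdot> (pX \<cdot> \<kappa>) = Null C P Y"
    have lpX: "l \<cdot> pX \<in> Hom C S Y" "(l \<cdot> pX) \<cdot> \<kappa> = Null C P Y" and Y: "Y \<in> Obj C"
      using l Comp_assoc[OF \<kappa>(1) H(2) l(1)] H Comp_closed Hom_Obj by auto
    obtain l' where l': "l' \<in> Hom C B Y" "l' \<cdot> \<phi> = l \<cdot> pX"
      using epi_cokernel_of_kernel[OF \<phi>_epi \<phi> \<kappa>(2,1) lpX] by blast
    have "l' \<cdot> f = l \<cdot> (pX \<cdot> iA)" using l_f[OF l'(1)] l'(2) Comp_assoc[OF H(3,2) l(1)] by simp
    also have "\<dots> = Null C A Y" using ortho(2) Comp_Null[OF l(1) ob(1)] by simp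
    finally have "l' = Null C B Y" using epi_arr_eq_Null[OF f l'(1)] by simp
    then have "l \<cdot> pX = Null C S Y" using l'(2) Null_Comp[OF \<phi> Y] by simp
    then have "l \<cdot> (pX \<cdot> iX) = Null C X Y"
      using Comp_assoc[OF H(4,2) l(1)] Null_Comp[OF H(4) Y] by simp
    then show "l = Null C X Y" using id Comp_Ident[OF l(1)] by simp
  qed
  have univ: "\<exists>h \<in> Hom C Y P. (pA \<cdot> \<kappa>) \<cdot> h = r \<and> (pX \<cdot> \<kappa>) \<cdot> h = s"
    if rs: "r \<in> Hom C Y A" "s \<in> Hom C Y X" "f \<cdot> r = g \<cdot> s" for Y r s
  proof -
    have Y: "Y \<in> Obj C" using rs Hom_Obj by blast
    have cl: "iA \<cdot> r \<in> Hom C Y S" "iX \<cdot> s \<in> Hom C Y S" "Null C Y A \<in> Hom C Y A"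
      using H rs Y ob Comp_closed Null_closed by blast+
    define h0 where "h0 = iA \<cdot> r \<oplus> iX \<cdot> s"
    have h0: "h0 \<in> Hom C Y S" unfolding h0_def using cl Plus_closed by blast
    have pA: "pA \<cdot> h0 = r"
      unfolding h0_def
      using Comp_Plus_right[OF cl(1,2) H(1)] Comp_assoc[OF rs(1) H(3,1)]
        Comp_assoc[OF rs(2) H(4,1)] id ortho Ident_Comp[OF rs(1)] Null_Comp[OF rs(2) ob(1)]
        Plus_commute[OF rs(1) cl(3)] Null_Plus[OF rs(1)] by simp
    have pX: "pX \<cdot> h0 = s"
      unfolding h0_def
      using Comp_Plus_right[OF cl(1,2) H(2)] Comp_assoc[OF rs(1) H(3,2)]
        Comp_assoc[OF rs(2) H(4,2)] id ortho Ident_Comp[OF rs(2)] Null_Comp[OF rs(1) ob(2)]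
        Null_Plus[OF rs(2)] by simp
    have "\<phi> \<cdot> h0 = Null C Y B" using \<phi>_Comp[OF h0] pA pX square[OF rs(1,2)] rs(3) by simp
    then obtain h where h: "h \<in> Hom C Y P" "\<kappa> \<cdot> h = h0"
      using kernel_factor[OF \<kappa>(2) \<phi> \<kappa>(1) h0] by blast
    then show ?thesis
      using Comp_assoc[OF h(1) \<kappa>(1) H(1)] Comp_assoc[OF h(1) \<kappa>(1) H(2)] pA pX by auto
  qed
  show thesis by (rule that[OF cl epi comm univ])
qed

lemma epi_lift:
  assumes "epi_arr C f" "f \<in> Hom C A B" "g \<in> Hom C X B"
  obtains Y e l where "e \<in> Hom C Y X" "epi_arr C e" "l \<in> Hom C Y A" "f \<cdot> l = g \<cdot> e"
proof (rule epi_pullback[OF assms])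
  fix P f' g'
  assume "f' \<in> Hom C P X" "g' \<in> Hom C P A" "epi_arr C f'" "f \<cdot> g' = g \<cdot> f'"
  then show thesis using that[of f' P g'] by simp
qed

text \<open>Suppose \<open>g \<cdot> q = 0\<close>, and let \<open>n\<close> be the kernel of \<open>g\<close>. Then \<open>f\<close> factors through the
  monomorphism \<open>m \<cdot> n\<close>, which is the kernel of some \<open>h\<close>. Since \<open>h\<close> kills \<open>f\<close>, it factors through
  the cokernel \<open>e\<close> of \<open>f\<close>, and thus kills \<open>m\<close>. So \<open>m\<close> factors through \<open>m \<cdot> n\<close>, which splits \<open>n\<close> and
  forces \<open>g = 0\<close>.\<close>

lemma image_factorization:
  assumes f: "f \<in> Hom C A B" and e: "is_cokernel C e f" "e \<in> Hom C B Q"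
    and m: "is_kernel C m e" "m \<in> Hom C I B"
  obtains q where "q \<in> Hom C A I" "epi_arr C q" "f = m \<cdot> q"
proof -
  obtain q where q: "q \<in> Hom C A I" "m \<cdot> q = f"
    using kernel_factor[OF m(1) e(2) m(2) f cokernel_comp[OF e(1) f e(2)]] by blast
  have "epi_arr C q"
  proof (rule epi_arr_zeroI[OF q(1)])
    fix X g assume g: "g \<in> Hom C I X" "g \<cdot> q = Null C A X"
    obtain N n where n: "n \<in> Hom C N I" "is_kernel C n g" using kernel_exists[OF g(1)] by blast
    obtain q' where q': "q' \<in> Hom C A N" "n \<cdot> q' = q"
      using kernel_factor[OF n(2) g(1) n(1) q(1) g(2)] by blast
    have mn: "m \<cdot> n \<in> Hom C N B" using n m Comp_closed by blast
    have "mono_arr C (m \<cdot> n)" using mono_Comp kernel_mono m n by blast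
    then obtain h where h: "is_kernel C (m \<cdot> n) h" using mono_is_kernel by blast
    then have hH: "h \<in> Hom C B (Cod C h)" using kernelD(1,2)[OF h] mn by (simp add: Hom_def)
    have "f = (m \<cdot> n) \<cdot> q'" using q q' Comp_assoc[OF q'(1) n(1) m(2)] by simp
    then have "h \<cdot> f = Null C A (Cod C h)"
      using Comp_eq_Null[OF kernel_comp[OF h hH mn] mn hH q'(1)] by simp
    then obtain h' where h': "h' \<in> Hom C Q (Cod C h)" "h' \<cdot> e = h"
      using cokernel_factor[OF e(1) f e(2) hH] by blast
    have "h \<cdot> m = Null C I (Cod C h)"
      using Comp_eq_Null'[OF kernel_comp[OF m(1) e(2) m(2)] m(2) e(2) h'(1)] h'(2) by simp
    then obtain r where r: "r \<in> Hom C I N" "(m \<cdot> n) \<cdot> r = m"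
      using kernel_factor[OF h hH mn m(2)] by blast
    have I: "I \<in> Obj C" using m Hom_Obj by blast
    have "m \<cdot> (n \<cdot> r) = m \<cdot> Ident C I"
      using r Comp_assoc[OF r(1) n(1) m(2)] Comp_Ident[OF m(2)] by simp
    then have nr: "n \<cdot> r = Ident C I"
      using mono_arrD[OF kernel_mono[OF m(1)] m(2) Comp_closed[OF r(1) n(1)] Ident_closed[OF I]]
      by simp
    have "g \<cdot> (n \<cdot> r) = Null C I X"
      using Comp_eq_Null[OF kernel_comp[OF n(2) g(1) n(1)] n(1) g(1) r(1)] .
    then show "g = Null C I X" using nr Comp_Ident[OF g(1)] by simp
  qed
  then show thesis using that q by blast
qed

text \<open>An element killed by the cokernel of \<open>f\<close> lies in the image of \<open>f\<close>, and \<open>f\<close> is an epimorphism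
  onto its image.\<close>

lemma cokernel_lift:
  assumes f: "f \<in> Hom C A B" and q: "is_cokernel C q f" "q \<in> Hom C B Q"
    and h: "h \<in> Hom C X B" "q \<cdot> h = Null C X Q"
  obtains Y e l where "e \<in> Hom C Y X" "epi_arr C e" "l \<in> Hom C Y A" "f \<cdot> l = h \<cdot> e"
proof -
  obtain I m where m: "m \<in> Hom C I B" "is_kernel C m q" using kernel_exists[OF q(2)] by blast
  obtain g where g: "g \<in> Hom C A I" "epi_arr C g" "f = m \<cdot> g"
    using image_factorization[OF f q m(2,1)] by blast
  obtain h' where h': "h' \<in> Hom C X I" "m \<cdot> h' = h"
    using kernel_factor[OF m(2) q(2) m(1) h] by blast
  obtain Y e l where l: "e \<in> Hom C Y X" "epi_arr C e" "l \<in> Hom C Y A" "g \<cdot> l = h' \<cdot> e"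
    using epi_lift[OF g(2,1) h'(1)] by blast
  have "f \<cdot> l = h \<cdot> e"
    using Comp_assoc[OF l(3) g(1) m(1)] Comp_assoc[OF l(1) h'(1) m(1)] g h' l by simp
  then show thesis using that l by blast
qed

text \<open>Let \<open>m\<close> be the image of \<open>f\<close>, realized as the kernel of the cokernel \<open>\<phi>\<close> of \<open>f\<close>. If an element
  lifts along \<open>f\<close> after restriction along an epimorphism, then \<open>\<phi>\<close> kills the restriction, hence the
  element itself, which therefore factors through \<open>m\<close> without any restriction.\<close>

lemma exact_pairI:
  assumes f: "f \<in> Hom C A B" and g: "g \<in> Hom C B D" and gf: "g \<cdot> f = Null C A D"
    and lift: "\<And>X h. \<lbrakk>h \<in> Hom C X B; g \<cdot> h = Null C X D\<rbrakk>
      \<Longrightarrow> \<exists>Y. \<exists>e \<in> Hom C Y X. epi_arr C e \<and> (\<exists>l \<in> Hom C Y A. f \<cdot> l = h \<cdot> e)"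
  shows "exact_pair C f g"
proof -
  obtain Q \<phi> where \<phi>: "\<phi> \<in> Hom C B Q" "is_cokernel C \<phi> f" using cokernel_exists[OF f] by blast
  obtain I m where m: "m \<in> Hom C I B" "is_kernel C m \<phi>" using kernel_exists[OF \<phi>(1)] by blast
  obtain q where q: "q \<in> Hom C A I" "epi_arr C q" "f = m \<cdot> q"
    using image_factorization[OF f \<phi>(2,1) m(2,1)] by blast
  obtain Q' \<psi> where \<psi>: "\<psi> \<in> Hom C D Q'" "is_cokernel C \<psi> g"
    using cokernel_exists[OF g] by blast
  obtain J n where n: "n \<in> Hom C J D" "is_kernel C n \<psi>" using kernel_exists[OF \<psi>(1)] by blast
  obtain p where p: "p \<in> Hom C B J" "epi_arr C p" "g = n \<cdot> p"
    using image_factorization[OF g \<psi>(2,1) n(2,1)] by blast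
  note mono_m = kernel_mono[OF m(2)] and mono_n = kernel_mono[OF n(2)]
  have pm: "p \<cdot> m \<in> Hom C I J" using p m Comp_closed by blast
  have "n \<cdot> ((p \<cdot> m) \<cdot> q) = Null C A D"
    using gf q(3) p(3) Comp_assoc[OF q(1) m(1) p(1)] Comp_assoc[OF f p(1) n(1)] by simp
  then have "(p \<cdot> m) \<cdot> q = Null C A J"
    using mono_arr_eq_Null[OF mono_n n(1) Comp_closed[OF q(1) pm]] by simp
  then have pm0: "p \<cdot> m = Null C I J" using epi_arr_eq_Null[OF q(2,1) pm] by simp
  have factor: "\<exists>h' \<in> Hom C X I. m \<cdot> h' = h" if h: "h \<in> Hom C X B" "p \<cdot> h = Null C X J" for X h
  proof -
    have "g \<cdot> h = Null C X D"
      using p(3) Comp_assoc[OF h(1) p(1) n(1)] h(2) Comp_Null[OF n(1)] Hom_Obj(1)[OF h(1)] by simp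
    then obtain Y e l where l: "e \<in> Hom C Y X" "epi_arr C e" "l \<in> Hom C Y A" "f \<cdot> l = h \<cdot> e"
      using lift h by blast
    have "(\<phi> \<cdot> h) \<cdot> e = Null C Y Q"
      using Comp_eq_Null[OF cokernel_comp[OF \<phi>(2) f \<phi>(1)] f \<phi>(1) l(3)] l(4)
        Comp_assoc[OF l(1) h(1) \<phi>(1)] by simp
    then have "\<phi> \<cdot> h = Null C X Q"
      using epi_arr_eq_Null[OF l(2,1) Comp_closed[OF h(1) \<phi>(1)]] by simp
    then show ?thesis using kernel_factor[OF m(2) \<phi>(1) m(1) h(1)] by blast
  qed
  have "is_kernel C m p"
    unfolding is_kernel_def
  proof (intro conjI allI ballI impI)
    show "p \<in> Arr C" "m \<in> Arr C" "Cod C m = Dom C p" "p \<cdot> m = Null C (Dom C m) (Cod C p)"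
      using p(1) m(1) pm0 by (auto simp: Hom_def)
  next
    fix X h assume "h \<in> Hom C X (Dom C p)" "p \<cdot> h = Null C X (Cod C p)"
    then have h: "h \<in> Hom C X B" "p \<cdot> h = Null C X J" using p(1) by (auto simp: Hom_def)
    have dm: "Dom C m = I" using m(1) by (simp add: Hom_def)
    show "\<exists>!h'. h' \<in> Hom C X (Dom C m) \<and> m \<cdot> h' = h"
      unfolding dm using factor[OF h] mono_arrD[OF mono_m m(1)] by metis
  qed
  moreover have "f \<in> Arr C" "g \<in> Arr C" "Cod C f = Dom C g" "Cod C q = Dom C m" "Cod C p = Dom C n"
    using f g q(1) m(1) p(1) n(1) by (auto simp: Hom_def)
  ultimately show ?thesis unfolding exact_pair_def using q p mono_m mono_n by blast
qed

end

section \<open>The snake diagram\<close>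

locale snake_diagram = abelian_category C
  for C :: "('o, 'm, 'x) ab_cat_scheme" (structure) +
  fixes A B D A' B' D' KerU KerV KerW CokerU CokerV CokerW :: 'o
    and a c b d u v w i j k p q r s t x y :: 'm
  assumes rows: "a \<in> Hom C A B" "c \<in> Hom C B D" "b \<in> Hom C A' B'" "d \<in> Hom C B' D'"
    and verticals: "u \<in> Hom C A A'" "v \<in> Hom C B B'" "w \<in> Hom C D D'"
    and commutes: "v \<cdot> a = b \<cdot> u" "w \<cdot> c = d \<cdot> v"
    and kernels: "i \<in> Hom C KerU A" "is_kernel C i u"
      "j \<in> Hom C KerV B" "is_kernel C j v"
      "k \<in> Hom C KerW D" "is_kernel C k w"
    and cokernels: "p \<in> Hom C A' CokerU" "is_cokernel C p u"
      "q \<in> Hom C B' CokerV" "is_cokernel C q v"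
      "r \<in> Hom C D' CokerW" "is_cokernel C r w"
    and c_coker: "is_cokernel C c a"
    and b_ker: "is_kernel C b d"
    and induced_ker: "s \<in> Hom C KerU KerV" "j \<cdot> s = a \<cdot> i"
      "t \<in> Hom C KerV KerW" "k \<cdot> t = c \<cdot> j"
    and induced_coker: "x \<in> Hom C CokerU CokerV" "x \<cdot> p = q \<cdot> b"
      "y \<in> Hom C CokerV CokerW" "y \<cdot> q = r \<cdot> d"
begin

lemmas mono_facts = kernel_mono[OF kernels(4)] kernel_mono[OF kernels(6)]
  kernel_mono[OF b_ker]

lemmas epi_facts = cokernel_epi[OF cokernels(2)] cokernel_epi[OF cokernels(4)]
  cokernel_epi[OF c_coker]

text \<open>Each commutative square and each vanishing composite is kept in the form in which it acts on an
  element.\<close>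

lemmas squares =
  Comp_square[OF commutes(1) rows(1) verticals(2) verticals(1) rows(3)]
  Comp_square[OF commutes(2) rows(2) verticals(3) verticals(2) rows(4)]
  Comp_square[OF induced_ker(2) induced_ker(1) kernels(3) kernels(1) rows(1)]
  Comp_square[OF induced_ker(4) induced_ker(3) kernels(5) kernels(3) rows(2)]
  Comp_square[OF induced_coker(2) cokernels(1) induced_coker(1) rows(3) cokernels(3)]
  Comp_square[OF induced_coker(4) cokernels(3) induced_coker(3) rows(4) cokernels(5)]

lemmas zeros =
  Comp_eq_Null[OF cokernel_comp[OF c_coker rows(1,2)] rows(1,2)]
  Comp_eq_Null[OF kernel_comp[OF b_ker rows(4,3)] rows(3,4)]
  Comp_eq_Null[OF kernel_comp[OF kernels(4) verticals(2) kernels(3)] kernels(3) verticals(2)]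
  Comp_eq_Null[OF kernel_comp[OF kernels(6) verticals(3) kernels(5)] kernels(5) verticals(3)]
  Comp_eq_Null[OF cokernel_comp[OF cokernels(2) verticals(1) cokernels(1)] verticals(1) cokernels(1)]
  Comp_eq_Null[OF cokernel_comp[OF cokernels(4) verticals(2) cokernels(3)] verticals(2) cokernels(3)]

text \<open>If \<open>t\<close> kills \<open>h\<close>, then \<open>j \<cdot> h\<close> lifts to some \<open>l\<close> in \<open>A\<close>; as \<open>b\<close> is a monomorphism, \<open>l\<close> lies in the
  kernel of \<open>u\<close>.\<close>

lemma exact_at_kernel_v: "exact_pair C s t"
proof (rule exact_pairI[OF induced_ker(1,3)])
  have "k \<cdot> (t \<cdot> s) = Null C KerU D"
    using squares(4)[OF induced_ker(1)] induced_ker(2) zeros(1)[OF kernels(1)] by simp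
  then show "t \<cdot> s = Null C KerU KerW"
    by (rule mono_arr_eq_Null[OF mono_facts(2) kernels(5) Comp_closed[OF induced_ker(1,3)]])
next
  fix X h assume h: "h \<in> Hom C X KerV" "t \<cdot> h = Null C X KerW"
  have jh: "j \<cdot> h \<in> Hom C X B" by (rule Comp_closed[OF h(1) kernels(3)])
  have "c \<cdot> (j \<cdot> h) = Null C X D"
    using squares(4)[OF h(1)] h(2) Comp_Null[OF kernels(5) Hom_Obj(1)[OF h(1)]] by simp
  then obtain Y e l where e: "e \<in> Hom C Y X" "epi_arr C e"
    and l: "l \<in> Hom C Y A" "a \<cdot> l = (j \<cdot> h) \<cdot> e"
    using cokernel_lift[OF rows(1) c_coker rows(2) jh] by blast
  have he: "h \<cdot> e \<in> Hom C Y KerV" by (rule Comp_closed[OF e(1) h(1)])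
  have al: "a \<cdot> l = j \<cdot> (h \<cdot> e)" using l(2) Comp_assoc[OF e(1) h(1) kernels(3)] by simp
  have "b \<cdot> (u \<cdot> l) = Null C Y B'" using squares(1)[OF l(1)] al zeros(3)[OF he] by simp
  then have "u \<cdot> l = Null C Y A'"
    by (rule mono_arr_eq_Null[OF mono_facts(3) rows(3) Comp_closed[OF l(1) verticals(1)]])
  then obtain m where m: "m \<in> Hom C Y KerU" "i \<cdot> m = l"
    using kernel_factor[OF kernels(2) verticals(1) kernels(1) l(1)] by blast
  have "j \<cdot> (s \<cdot> m) = j \<cdot> (h \<cdot> e)" using squares(3)[OF m(1)] m(2) al by simp
  then have "s \<cdot> m = h \<cdot> e"
    by (rule mono_arrD[OF mono_facts(1) kernels(3) Comp_closed[OF m(1) induced_ker(1)] he])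
  then show "\<exists>Y. \<exists>e \<in> Hom C Y X. epi_arr C e \<and> (\<exists>l \<in> Hom C Y KerU. s \<cdot> l = h \<cdot> e)"
    using e m(1) by blast
qed

text \<open>An element of \<open>Ker w\<close> can be carried back to \<open>B\<close> because \<open>c\<close> is an epimorphism, and then on to
  \<open>A'\<close> because \<open>v \<cdot> \<beta>\<close> lies in the kernel of \<open>d\<close>.\<close>

lemma zigzag_exists:
  assumes h: "h \<in> Hom C X KerW"
  obtains Y e \<beta> \<alpha> where "e \<in> Hom C Y X" "epi_arr C e" "\<beta> \<in> Hom C Y B" "\<alpha> \<in> Hom C Y A'"
    "c \<cdot> \<beta> = k \<cdot> (h \<cdot> e)" "v \<cdot> \<beta> = b \<cdot> \<alpha>"
proof -
  have kh: "k \<cdot> h \<in> Hom C X D" by (rule Comp_closed[OF h kernels(5)])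
  obtain Y e \<beta> where e: "e \<in> Hom C Y X" "epi_arr C e"
    and \<beta>: "\<beta> \<in> Hom C Y B" "c \<cdot> \<beta> = (k \<cdot> h) \<cdot> e"
    using epi_lift[OF epi_facts(3) rows(2) kh] by blast
  have c\<beta>: "c \<cdot> \<beta> = k \<cdot> (h \<cdot> e)" using \<beta>(2) Comp_assoc[OF e(1) h kernels(5)] by simp
  have "d \<cdot> (v \<cdot> \<beta>) = Null C Y D'"
    using squares(2)[OF \<beta>(1)] c\<beta> zeros(4)[OF Comp_closed[OF e(1) h]] by simp
  then obtain \<alpha> where "\<alpha> \<in> Hom C Y A'" "b \<cdot> \<alpha> = v \<cdot> \<beta>"
    using kernel_factor[OF b_ker rows(4,3) Comp_closed[OF \<beta>(1) verticals(2)]] by blast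
  then show thesis using that[OF e \<beta>(1) _ c\<beta>] by simp
qed

text \<open>The second property says that the zigzag through \<open>\<beta>\<close> and \<open>\<alpha>\<close> computes \<open>\<delta>\<close> for every choice of
  \<open>\<beta>\<close>, also when \<open>\<beta>\<close> is not produced by \<open>zigzag_exists\<close>.\<close>

lemma connecting_arrow_exists:
  obtains \<delta> where "\<delta> \<in> Hom C KerW CokerU"
    "\<And>X \<beta> h \<alpha>. \<lbrakk>\<beta> \<in> Hom C X B; h \<in> Hom C X KerW; \<alpha> \<in> Hom C X A'; c \<cdot> \<beta> = k \<cdot> h; v \<cdot> \<beta> = b \<cdot> \<alpha>\<rbrakk>
      \<Longrightarrow> \<delta> \<cdot> h = p \<cdot> \<alpha>"
proof (rule epi_pullback[OF epi_facts(3) rows(2) kernels(5)])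
  fix P c' k'
  assume c': "c' \<in> Hom C P KerW" "epi_arr C c'" and k': "k' \<in> Hom C P B"
    and sq: "c \<cdot> k' = k \<cdot> c'"
    and univ: "\<And>Y r s. \<lbrakk>r \<in> Hom C Y B; s \<in> Hom C Y KerW; c \<cdot> r = k \<cdot> s\<rbrakk>
      \<Longrightarrow> \<exists>h \<in> Hom C Y P. k' \<cdot> h = r \<and> c' \<cdot> h = s"
  have "d \<cdot> (v \<cdot> k') = Null C P D'" using squares(2)[OF k'] sq zeros(4)[OF c'(1)] by simp
  then obtain z where z: "z \<in> Hom C P A'" "b \<cdot> z = v \<cdot> k'"
    using kernel_factor[OF b_ker rows(4,3) Comp_closed[OF k' verticals(2)]] by blast
  have pz: "p \<cdot> z \<in> Hom C P CokerU" by (rule Comp_closed[OF z(1) cokernels(1)])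
  \<comment> \<open>\<open>p \<cdot> z\<close> descends along \<open>c'\<close>: on the kernel \<open>n\<close> of \<open>c'\<close> the element of \<open>B\<close> comes from \<open>A\<close>,
    so that \<open>z\<close> comes from \<open>A\<close> through \<open>u\<close>, at least after restriction along \<open>e\<close>.\<close>
  obtain N n where n: "n \<in> Hom C N P" "is_kernel C n c'" using kernel_exists[OF c'(1)] by blast
  have k'n: "k' \<cdot> n \<in> Hom C N B" by (rule Comp_closed[OF n(1) k'])
  have "c \<cdot> (k' \<cdot> n) = Null C N D"
    using Comp_square[OF sq k' rows(2) c'(1) kernels(5) n(1)] kernel_comp[OF n(2) c'(1) n(1)]
      Comp_Null[OF kernels(5) Hom_Obj(1)[OF n(1)]] by simp
  then obtain Y e l where e: "e \<in> Hom C Y N" "epi_arr C e"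
    and l: "l \<in> Hom C Y A" "a \<cdot> l = (k' \<cdot> n) \<cdot> e"
    using cokernel_lift[OF rows(1) c_coker rows(2) k'n] by blast
  have ne: "n \<cdot> e \<in> Hom C Y P" by (rule Comp_closed[OF e(1) n(1)])
  have "b \<cdot> (u \<cdot> l) = b \<cdot> (z \<cdot> (n \<cdot> e))"
    using squares(1)[OF l(1)] l(2) Comp_assoc[OF e(1) n(1) k']
      Comp_square[OF z(2) z(1) rows(3) k' verticals(2) ne] by simp
  then have "u \<cdot> l = z \<cdot> (n \<cdot> e)"
    by (rule mono_arrD[OF mono_facts(3) rows(3) Comp_closed[OF l(1) verticals(1)] Comp_closed[OF ne z(1)]])
  then have "((p \<cdot> z) \<cdot> n) \<cdot> e = Null C Y CokerU"
    using zeros(5)[OF l(1)] Comp_assoc[OF ne z(1) cokernels(1)] Comp_assoc[OF e(1) n(1) pz] by simp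
  then have "(p \<cdot> z) \<cdot> n = Null C N CokerU"
    by (rule epi_arr_eq_Null[OF e(2,1) Comp_closed[OF n(1) pz]])
  then obtain \<delta> where \<delta>: "\<delta> \<in> Hom C KerW CokerU" "\<delta> \<cdot> c' = p \<cdot> z"
    using epi_cokernel_of_kernel[OF c'(2,1) n(2,1) pz] by blast
  have "\<delta> \<cdot> h = p \<cdot> \<alpha>"
    if H: "\<beta> \<in> Hom C X B" "h \<in> Hom C X KerW" "\<alpha> \<in> Hom C X A'" "c \<cdot> \<beta> = k \<cdot> h" "v \<cdot> \<beta> = b \<cdot> \<alpha>"
    for X \<beta> h \<alpha>
  proof -
    obtain g where g: "g \<in> Hom C X P" "k' \<cdot> g = \<beta>" "c' \<cdot> g = h" using univ[OF H(1,2,4)] by blast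
    have "b \<cdot> (z \<cdot> g) = b \<cdot> \<alpha>"
      using Comp_square[OF z(2) z(1) rows(3) k' verticals(2) g(1)] g(2) H(5) by simp
    then have "z \<cdot> g = \<alpha>" by (rule mono_arrD[OF mono_facts(3) rows(3) Comp_closed[OF g(1) z(1)] H(3)])
    then show ?thesis
      using Comp_square[OF \<delta>(2) c'(1) \<delta>(1) z(1) cokernels(1) g(1)] g(3) by simp
  qed
  then show thesis using that[OF \<delta>(1)] by blast
qed

context
  fixes \<delta>
  assumes \<delta>: "\<delta> \<in> Hom C KerW CokerU"
    and \<delta>_zigzag: "\<And>X \<beta> h \<alpha>. \<lbrakk>\<beta> \<in> Hom C X B; h \<in> Hom C X KerW; \<alpha> \<in> Hom C X A';
      c \<cdot> \<beta> = k \<cdot> h; v \<cdot> \<beta> = b \<cdot> \<alpha>\<rbrakk> \<Longrightarrow> \<delta> \<cdot> h = p \<cdot> \<alpha>"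
begin

text \<open>If \<open>\<delta>\<close> kills \<open>h\<close>, then the \<open>\<alpha>\<close> of its zigzag comes from some \<open>l\<close> in \<open>A\<close>. Correcting \<open>\<beta>\<close> by
  \<open>a \<cdot> l\<close> leaves its image under \<open>c\<close> unchanged and makes it an element of \<open>Ker v\<close>.\<close>

lemma exact_at_kernel_w: "exact_pair C t \<delta>"
proof (rule exact_pairI[OF induced_ker(3) \<delta>])
  have ob: "KerV \<in> Obj C" "A' \<in> Obj C"
    using Hom_Obj(1)[OF kernels(3)] Hom_Obj(1)[OF rows(3)] by simp_all
  \<comment> \<open>The composite is the zigzag with \<open>\<beta> = j\<close> and \<open>\<alpha> = 0\<close>.\<close>
  have "v \<cdot> j = b \<cdot> Null C KerV A'"
    using kernel_comp[OF kernels(4) verticals(2) kernels(3)] Comp_Null[OF rows(3) ob(1)] by simp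
  then show "\<delta> \<cdot> t = Null C KerV CokerU"
    using \<delta>_zigzag[OF kernels(3) induced_ker(3) Null_closed[OF ob] induced_ker(4)[symmetric]]
      Comp_Null[OF cokernels(1) ob(1)] by simp
next
  fix X h assume h: "h \<in> Hom C X KerW" "\<delta> \<cdot> h = Null C X CokerU"
  obtain Y e \<beta> \<alpha> where e: "e \<in> Hom C Y X" "epi_arr C e"
    and \<beta>: "\<beta> \<in> Hom C Y B" and \<alpha>: "\<alpha> \<in> Hom C Y A'"
    and zz: "c \<cdot> \<beta> = k \<cdot> (h \<cdot> e)" "v \<cdot> \<beta> = b \<cdot> \<alpha>"
    by (rule zigzag_exists[OF h(1)])
  have he: "h \<cdot> e \<in> Hom C Y KerW" by (rule Comp_closed[OF e(1) h(1)])
  have "p \<cdot> \<alpha> = Null C Y CokerU"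
    using \<delta>_zigzag[OF \<beta> he \<alpha> zz] Comp_eq_Null[OF h(2,1) \<delta> e(1)] by simp
  then obtain Z e' l where e': "e' \<in> Hom C Z Y" "epi_arr C e'"
    and l: "l \<in> Hom C Z A" "u \<cdot> l = \<alpha> \<cdot> e'"
    using cokernel_lift[OF verticals(1) cokernels(2,1) \<alpha>] by blast
  have cl: "\<beta> \<cdot> e' \<in> Hom C Z B" "a \<cdot> l \<in> Hom C Z B"
    by (rule Comp_closed[OF e'(1) \<beta>], rule Comp_closed[OF l(1) rows(1)])
  have "v \<cdot> (\<beta> \<cdot> e') = v \<cdot> (a \<cdot> l)"
    using squares(1)[OF l(1)] l(2) Comp_square[OF zz(2) \<beta> verticals(2) \<alpha> rows(3) e'(1)] by simp
  then obtain g where g: "g \<in> Hom C Z B" "g \<oplus> a \<cdot> l = \<beta> \<cdot> e'" "v \<cdot> g = Null C Z B'"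
    using difference_annihilated[OF cl verticals(2)] by blast
  obtain m where m: "m \<in> Hom C Z KerV" "j \<cdot> m = g"
    using kernel_factor[OF kernels(4) verticals(2) kernels(3) g(1,3)] by blast
  have ee: "e \<cdot> e' \<in> Hom C Z X" by (rule Comp_closed[OF e'(1) e(1)])
  have hee: "h \<cdot> (e \<cdot> e') \<in> Hom C Z KerW" by (rule Comp_closed[OF ee h(1)])
  have cg: "c \<cdot> g \<in> Hom C Z D" by (rule Comp_closed[OF g(1) rows(2)])
  have "c \<cdot> (\<beta> \<cdot> e') = c \<cdot> g"
    using Comp_Plus_right[OF g(1) cl(2) rows(2)] g(2) zeros(1)[OF l(1)]
      Plus_commute[OF cg Null_closed[OF Hom_Obj[OF cg]]] Null_Plus[OF cg] by simp
  then have "k \<cdot> (t \<cdot> m) = k \<cdot> (h \<cdot> (e \<cdot> e'))"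
    using squares(4)[OF m(1)] m(2) Comp_square[OF zz(1) \<beta> rows(2) he kernels(5) e'(1)]
      Comp_assoc[OF e'(1) e(1) h(1)] by simp
  then have "t \<cdot> m = h \<cdot> (e \<cdot> e')"
    by (rule mono_arrD[OF mono_facts(2) kernels(5) Comp_closed[OF m(1) induced_ker(3)] hee])
  then show "\<exists>Y. \<exists>e \<in> Hom C Y X. epi_arr C e \<and> (\<exists>l \<in> Hom C Y KerV. t \<cdot> l = h \<cdot> e)"
    using ee epi_Comp[OF e'(2,1) e(2,1)] m(1) by blast
qed

text \<open>If \<open>x\<close> kills the class of \<open>\<alpha>\<close>, then \<open>b \<cdot> \<alpha>\<close> comes from some \<open>\<beta>\<close> along \<open>v\<close>, and \<open>c \<cdot> \<beta>\<close> lies in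
  \<open>Ker w\<close>; this is a zigzag that ends in the given class.\<close>

lemma exact_at_cokernel_u: "exact_pair C \<delta> x"
proof (rule exact_pairI[OF \<delta> induced_coker(1)])
  \<comment> \<open>The composite vanishes if it does so on the universal element of \<open>Ker w\<close>, the identity.\<close>
  note id = Ident_closed[OF Hom_Obj(1)[OF kernels(5)]]
  obtain Y e \<beta> \<alpha> where e: "e \<in> Hom C Y KerW" "epi_arr C e"
    and \<beta>: "\<beta> \<in> Hom C Y B" and \<alpha>: "\<alpha> \<in> Hom C Y A'"
    and zz: "c \<cdot> \<beta> = k \<cdot> (Ident C KerW \<cdot> e)" "v \<cdot> \<beta> = b \<cdot> \<alpha>"
    by (rule zigzag_exists[OF id])
  have "\<delta> \<cdot> e = p \<cdot> \<alpha>" using \<delta>_zigzag[OF \<beta> e(1) \<alpha> _ zz(2)] zz(1) Ident_Comp[OF e(1)] by simp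
  then have "(x \<cdot> \<delta>) \<cdot> e = Null C Y CokerV"
    using Comp_assoc[OF e(1) \<delta> induced_coker(1)] squares(5)[OF \<alpha>] zz(2) zeros(6)[OF \<beta>] by simp
  then show "x \<cdot> \<delta> = Null C KerW CokerV"
    by (rule epi_arr_eq_Null[OF e(2,1) Comp_closed[OF \<delta> induced_coker(1)]])
next
  fix X h assume h: "h \<in> Hom C X CokerU" "x \<cdot> h = Null C X CokerV"
  obtain Y e \<alpha> where e: "e \<in> Hom C Y X" "epi_arr C e"
    and \<alpha>: "\<alpha> \<in> Hom C Y A'" "p \<cdot> \<alpha> = h \<cdot> e"
    using epi_lift[OF epi_facts(1) cokernels(1) h(1)] by blast
  have b\<alpha>: "b \<cdot> \<alpha> \<in> Hom C Y B'" by (rule Comp_closed[OF \<alpha>(1) rows(3)])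
  have "q \<cdot> (b \<cdot> \<alpha>) = Null C Y CokerV"
    using squares(5)[OF \<alpha>(1)] \<alpha>(2) Comp_eq_Null[OF h(2,1) induced_coker(1) e(1)] by simp
  then obtain Z e' \<beta> where e': "e' \<in> Hom C Z Y" "epi_arr C e'"
    and \<beta>: "\<beta> \<in> Hom C Z B" "v \<cdot> \<beta> = (b \<cdot> \<alpha>) \<cdot> e'"
    using cokernel_lift[OF verticals(2) cokernels(4,3) b\<alpha>] by blast
  have \<alpha>e: "\<alpha> \<cdot> e' \<in> Hom C Z A'" by (rule Comp_closed[OF e'(1) \<alpha>(1)])
  have v\<beta>: "v \<cdot> \<beta> = b \<cdot> (\<alpha> \<cdot> e')" using \<beta>(2) Comp_assoc[OF e'(1) \<alpha>(1) rows(3)] by simp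
  have "w \<cdot> (c \<cdot> \<beta>) = Null C Z D'" using squares(2)[OF \<beta>(1)] v\<beta> zeros(2)[OF \<alpha>e] by simp
  then obtain m where m: "m \<in> Hom C Z KerW" "k \<cdot> m = c \<cdot> \<beta>"
    using kernel_factor[OF kernels(6) verticals(3) kernels(5) Comp_closed[OF \<beta>(1) rows(2)]] by blast
  have "\<delta> \<cdot> m = h \<cdot> (e \<cdot> e')"
    using \<delta>_zigzag[OF \<beta>(1) m(1) \<alpha>e m(2)[symmetric] v\<beta>]
      Comp_square[OF \<alpha>(2,1) cokernels(1) e(1) h(1) e'(1)] by simp
  then show "\<exists>Y. \<exists>e \<in> Hom C Y X. epi_arr C e \<and> (\<exists>l \<in> Hom C Y KerW. \<delta> \<cdot> l = h \<cdot> e)"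
    using Comp_closed[OF e'(1) e(1)] epi_Comp[OF e'(2,1) e(2,1)] m(1) by blast
qed

end

text \<open>If \<open>y\<close> kills the class of \<open>z\<close>, then \<open>d \<cdot> z\<close> comes from \<open>D\<close> along \<open>w\<close>, hence from some \<open>m\<close> in \<open>B\<close>.
  Correcting \<open>z\<close> by \<open>v \<cdot> m\<close> keeps its class and makes it an element of \<open>A'\<close>.\<close>

lemma exact_at_cokernel_v: "exact_pair C x y"
proof (rule exact_pairI[OF induced_coker(1,3)])
  note yx = Comp_closed[OF induced_coker(1,3)]
  have "(y \<cdot> x) \<cdot> p = r \<cdot> (d \<cdot> b)"
    using Comp_assoc[OF cokernels(1) induced_coker(1,3)] induced_coker(2) squares(6)[OF rows(3)]
    by simp
  also have "\<dots> = Null C A' CokerW"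
    using kernel_comp[OF b_ker rows(4,3)] Comp_Null[OF cokernels(5) Hom_Obj(1)[OF rows(3)]] by simp
  finally show "y \<cdot> x = Null C CokerU CokerW" by (rule epi_arr_eq_Null[OF epi_facts(1) cokernels(1) yx])
next
  fix X h assume h: "h \<in> Hom C X CokerV" "y \<cdot> h = Null C X CokerW"
  obtain Y e z where e: "e \<in> Hom C Y X" "epi_arr C e"
    and z: "z \<in> Hom C Y B'" "q \<cdot> z = h \<cdot> e"
    using epi_lift[OF epi_facts(2) cokernels(3) h(1)] by blast
  have dz: "d \<cdot> z \<in> Hom C Y D'" by (rule Comp_closed[OF z(1) rows(4)])
  have "r \<cdot> (d \<cdot> z) = Null C Y CokerW"
    using squares(6)[OF z(1)] z(2) Comp_eq_Null[OF h(2,1) induced_coker(3) e(1)] by simp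
  then obtain Z e' l where e': "e' \<in> Hom C Z Y" "epi_arr C e'"
    and l: "l \<in> Hom C Z D" "w \<cdot> l = (d \<cdot> z) \<cdot> e'"
    using cokernel_lift[OF verticals(3) cokernels(6,5) dz] by blast
  obtain V f m where f: "f \<in> Hom C V Z" "epi_arr C f"
    and m: "m \<in> Hom C V B" "c \<cdot> m = l \<cdot> f"
    using epi_lift[OF epi_facts(3) rows(2) l(1)] by blast
  have ef: "e' \<cdot> f \<in> Hom C V Y" "epi_arr C (e' \<cdot> f)"
    by (rule Comp_closed[OF f(1) e'(1)], rule epi_Comp[OF f(2,1) e'(2,1)])
  have cl: "z \<cdot> (e' \<cdot> f) \<in> Hom C V B'" "v \<cdot> m \<in> Hom C V B'"
    by (rule Comp_closed[OF ef(1) z(1)], rule Comp_closed[OF m(1) verticals(2)])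
  have "d \<cdot> (v \<cdot> m) = w \<cdot> (l \<cdot> f)" using squares(2)[OF m(1)] m(2) by simp
  also have "\<dots> = d \<cdot> (z \<cdot> (e' \<cdot> f))"
    using Comp_square[OF l(2,1) verticals(3) e'(1) dz f(1)] Comp_assoc[OF ef(1) z(1) rows(4)]
    by simp
  finally have "d \<cdot> (z \<cdot> (e' \<cdot> f)) = d \<cdot> (v \<cdot> m)" by (rule sym)
  then obtain g where g: "g \<in> Hom C V B'" "g \<oplus> v \<cdot> m = z \<cdot> (e' \<cdot> f)" "d \<cdot> g = Null C V D'"
    using difference_annihilated[OF cl rows(4)] by blast
  obtain n where n: "n \<in> Hom C V A'" "b \<cdot> n = g"
    using kernel_factor[OF b_ker rows(4,3) g(1,3)] by blast
  have qg: "q \<cdot> g \<in> Hom C V CokerV" by (rule Comp_closed[OF g(1) cokernels(3)])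
  have "q \<cdot> (z \<cdot> (e' \<cdot> f)) = q \<cdot> g"
    using Comp_Plus_right[OF g(1) cl(2) cokernels(3)] g(2) zeros(6)[OF m(1)]
      Plus_commute[OF qg Null_closed[OF Hom_Obj[OF qg]]] Null_Plus[OF qg] by simp
  then have "x \<cdot> (p \<cdot> n) = h \<cdot> (e \<cdot> (e' \<cdot> f))"
    using squares(5)[OF n(1)] n(2) Comp_square[OF z(2,1) cokernels(3) e(1) h(1) ef(1)] by simp
  then show "\<exists>Y. \<exists>e \<in> Hom C Y X. epi_arr C e \<and> (\<exists>l \<in> Hom C Y CokerU. x \<cdot> l = h \<cdot> e)"
    using Comp_closed[OF ef(1) e(1)] epi_Comp[OF ef(2,1) e(2,1)] Comp_closed[OF n(1) cokernels(1)]
    by blast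
qed

end

theorem mainTheorem1:
  fixes C :: "('o, 'm, 'x) ab_cat_scheme" (structure)
  assumes abelian: "abelian_category C"
    and rows: "a \<in> Hom C A B" "c \<in> Hom C B D" "b \<in> Hom C A' B'" "d \<in> Hom C B' D'"
    and verticals: "u \<in> Hom C A A'" "v \<in> Hom C B B'" "w \<in> Hom C D D'"
    and commutes: "v \<cdot> a = b \<cdot> u" "w \<cdot> c = d \<cdot> v"
    and kernels: "i \<in> Hom C KerU A" "is_kernel C i u"
      "j \<in> Hom C KerV B" "is_kernel C j v"
      "k \<in> Hom C KerW D" "is_kernel C k w"
    and cokernels: "p \<in> Hom C A' CokerU" "is_cokernel C p u"
      "q \<in> Hom C B' CokerV" "is_cokernel C q v"
      "r \<in> Hom C D' CokerW" "is_cokernel C r w"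
    and c_coker: "is_cokernel C c a"
    and b_ker: "is_kernel C b d"
    and induced_ker: "s \<in> Hom C KerU KerV" "j \<cdot> s = a \<cdot> i"
      "t \<in> Hom C KerV KerW" "k \<cdot> t = c \<cdot> j"
    and induced_coker: "x \<in> Hom C CokerU CokerV" "x \<cdot> p = q \<cdot> b"
      "y \<in> Hom C CokerV CokerW" "y \<cdot> q = r \<cdot> d"
  shows "\<exists>\<delta> \<in> Hom C KerW CokerU. exact_sequence C [s, t, \<delta>, x, y]"
proof -
  interpret snake_diagram C A B D A' B' D' KerU KerV KerW CokerU CokerV CokerW
      a c b d u v w i j k p q r s t x y
    using assms by (intro snake_diagram.intro snake_diagram_axioms.intro)
  show ?thesis
  proof (rule connecting_arrow_exists)
    fix \<delta>
    assume \<delta>: "\<delta> \<in> Hom C KerW CokerU"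
      and zigzag: "\<And>X \<beta> h \<alpha>. \<lbrakk>\<beta> \<in> Hom C X B; h \<in> Hom C X KerW; \<alpha> \<in> Hom C X A';
        c \<cdot> \<beta> = k \<cdot> h; v \<cdot> \<beta> = b \<cdot> \<alpha>\<rbrakk> \<Longrightarrow> \<delta> \<cdot> h = p \<cdot> \<alpha>"
    have kw: "exact_pair C t \<delta>" by (rule exact_at_kernel_w[OF \<delta>]) (rule zigzag)
    have cu: "exact_pair C \<delta> x" by (rule exact_at_cokernel_u[OF \<delta>]) (rule zigzag)
    have "exact_pair C ([s, t, \<delta>, x, y] ! l) ([s, t, \<delta>, x, y] ! Suc l)" if "l < 4" for l
    proof -
      consider "l = 0" | "l = 1" | "l = 2" | "l = 3" using \<open>l < 4\<close> by linarith
      then show ?thesis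
        by cases (simp_all add: exact_at_kernel_v kw cu exact_at_cokernel_v numeral_eq_Suc)
    qed
    then have "exact_sequence C [s, t, \<delta>, x, y]" unfolding exact_sequence_def by simp
    then show ?thesis using \<delta> by blast
  qed
qed

end
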